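(* Let $(X,f_{1,\infty})$ be a finitely generated non-autonomous discrete system. Suppose that (1) $(X,f_{1,\infty})$ is topologically transitive; (2) the periodic points of $(X,f_{1,\infty})$ are dense in $X$; (3) there exist two invariant periodic points $x,y\in X$ with $\overline{\mathrm{orb}(x,f_{1,\infty})}\cap\overline{\mathrm{orb}(y,f_{1,\infty})}=\emptyset$. Then $(X,f_{1,\infty})$ is sensitive.
   Context: $\mathbb{N}=\{1,2,3,\dots\}$. A non-autonomous discrete system (NDS) $(X,f_{1,\infty})$ consists of a metric space $(X,d)$ and a sequence $f_{1,\infty}=(f_n)_{n=1}^\infty$ of continuous maps $f_n:X\to X$. For $i,n\in\mathbb{N}$, $f_i^n:=f_{i+n-1}\circ\cdots\circ f_i$, and $f_i^0=\mathrm{id}_X$. The orbit of $x$ is $\mathrm{orb}(x,f_{1,\infty})=\{x,f_1^1(x),f_1^2(x),\dots\}$. Finitely generated: there is a finite set $F$ of continuous self-maps of $X$ such that every $f_i$ belongs to $F$. Topologically transitive: for any two non-empty open sets $U,V\subseteq X$ there is $n\in\mathbb{N}$ with $f_1^n(U)\cap V\neq\emptyset$. Periodic point: a point $x\in X$ for which there is $k\in\mathbb{N}$ with $f_1^{kn}(x)=x$ for all $n\in\mathbb{N}$. Invariant set: a non-empty set $U\subseteq X$ with $f_i(U)\subseteq U$ for all $i\in\mathbb{N}$. An invariant periodic point is a periodic point whose orbit $\mathrm{orb}(x,f_{1,\infty})$ is an invariant set. Sensitive: there is $\delta>0$ such that for any non-empty open set $U\subseteq X$ there exist $x,y\in U$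 and $n\in\mathbb{N}$ with $d(f_1^n(x),f_1^n(y))>\delta$. *)

theory Defs
  imports "HOL-Analysis.Analysis"
begin

text \<open>The metric space is the whole type \<open>'a\<close>. A sequence of maps is a function on \<open>nat\<close> of
  which only the values at indices \<open>i \<ge> 1\<close> are relevant; the value at \<open>0\<close> is never used.\<close>

definition nds :: "(nat \<Rightarrow> 'a::metric_space \<Rightarrow> 'a) \<Rightarrow> bool" where
  "nds f \<longleftrightarrow> (\<forall>i\<ge>1. continuous_on UNIV (f i))"

text \<open>\<open>nds_iter f i n\<close> is \<open>f (i+n-1) \<circ> \<dots> \<circ> f i\<close>, with \<open>n\<close> factors.\<close>

primrec nds_iter :: "(nat \<Rightarrow> 'a \<Rightarrow> 'a) \<Rightarrow> nat \<Rightarrow> nat \<Rightarrow> 'a \<Rightarrow> 'a" where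
  "nds_iter f i 0 = id"
| "nds_iter f i (Suc n) = f (i + n) \<circ> nds_iter f i n"

definition nds_orbit :: "(nat \<Rightarrow> 'a \<Rightarrow> 'a) \<Rightarrow> 'a \<Rightarrow> 'a set" where
  "nds_orbit f x = {nds_iter f 1 n x | n. True}"

definition finitely_generated :: "(nat \<Rightarrow> 'a::metric_space \<Rightarrow> 'a) \<Rightarrow> bool" where
  "finitely_generated f \<longleftrightarrow>
     (\<exists>F. finite F \<and> (\<forall>g\<in>F. continuous_on UNIV g) \<and> (\<forall>i\<ge>1. f i \<in> F))"

definition topologically_transitive :: "(nat \<Rightarrow> 'a::metric_space \<Rightarrow> 'a) \<Rightarrow> bool" where
  "topologically_transitive f \<longleftrightarrow>
     (\<forall>U V. open U \<and> U \<noteq> {} \<and> open V \<and> V \<noteq> {} \<longrightarrow>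
        (\<exists>n\<ge>1. nds_iter f 1 n ` U \<inter> V \<noteq> {}))"

definition periodic_point :: "(nat \<Rightarrow> 'a \<Rightarrow> 'a) \<Rightarrow> 'a \<Rightarrow> bool" where
  "periodic_point f x \<longleftrightarrow> (\<exists>k\<ge>1. \<forall>n\<ge>1. nds_iter f 1 (k * n) x = x)"

definition invariant_set :: "(nat \<Rightarrow> 'a \<Rightarrow> 'a) \<Rightarrow> 'a set \<Rightarrow> bool" where
  "invariant_set f U \<longleftrightarrow> U \<noteq> {} \<and> (\<forall>i\<ge>1. f i ` U \<subseteq> U)"

definition invariant_periodic_point :: "(nat \<Rightarrow> 'a \<Rightarrow> 'a) \<Rightarrow> 'a \<Rightarrow> bool" where
  "invariant_periodic_point f x \<longleftrightarrow> periodic_point f x \<and> invariant_set f (nds_orbit f x)"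

definition sensitive :: "(nat \<Rightarrow> 'a::metric_space \<Rightarrow> 'a) \<Rightarrow> bool" where
  "sensitive f \<longleftrightarrow>
     (\<exists>\<delta>>0. \<forall>U. open U \<and> U \<noteq> {} \<longrightarrow>
        (\<exists>x\<in>U. \<exists>y\<in>U. \<exists>n\<ge>1. dist (nds_iter f 1 n x) (nds_iter f 1 n y) > \<delta>))"

end

theory Submission
  imports Defs
begin

text \<open>Finite generation leaves, for each \<open>n\<close>, only finitely many maps \<open>nds_iter f i n\<close>.
  Hence periodic orbits are finite and the two given orbits lie a positive distance \<open>8 * e\<close>
  apart, so every point \<open>z\<close> is at distance at least \<open>4 * e\<close> from one of them, the orbit of \<open>q\<close>, say.
  Given a periodic point \<open>p\<close> near \<open>z\<close> of period \<open>k\<close>, the points that stay \<open>e\<close>-close to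
  the orbit of \<open>q\<close> under all blocks of at most \<open>k\<close> maps form an open neighbourhood of \<open>q\<close>.
  By transitivity some \<open>u\<close> near \<open>z\<close> enters it, and at the next multiple of \<open>k\<close> the point
  \<open>u\<close> is still near the orbit of \<open>q\<close>, whereas \<open>p\<close> is back near \<open>z\<close>.\<close>

lemma nds_iter_add: "nds_iter f i (m + n) = nds_iter f (i + m) n \<circ> nds_iter f i m"
  by (induction n) (simp_all add: o_assoc add.assoc)

lemma invariant_set_nds_iter:
  assumes "invariant_set f U" "i \<ge> 1" "x \<in> U"
  shows "nds_iter f i n x \<in> U"
proof (induction n)
  case 0
  show ?case using assms by simp
next
  case (Suc n)
  have "f (i + n) ` U \<subseteq> U"
    using assms by (simp add: invariant_set_def)
  with Suc show ?case by auto
qed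

lemma continuous_on_nds_iter:
  assumes "nds f" "i \<ge> 1"
  shows "continuous_on UNIV (nds_iter f i n)"
proof (induction n)
  case 0
  show ?case by (simp add: id_def continuous_on_id)
next
  case (Suc n)
  have "continuous_on UNIV (f (i + n))"
    using assms by (simp add: nds_def)
  then have "continuous_on (nds_iter f i n ` UNIV) (f (i + n))"
    by (rule continuous_on_subset) simp
  with Suc show ?case
    unfolding nds_iter.simps by (rule continuous_on_compose)
qed

text \<open>Each such map is a composite of \<open>n\<close> members of the finite generating set,
  whatever the starting index.\<close>

lemma finite_nds_iter_maps:
  assumes "finitely_generated f"
  shows "finite ((\<lambda>i. nds_iter f i n) ` {1..})"
proof (induction n)
  case 0
  show ?case by (rule finite_subset[of _ "{id}"]) auto
next
  case (Suc n)
  obtain F where F: "finite F" "\<And>i. i \<ge> 1 \<Longrightarrow> f i \<in> F"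
    using assms by (auto simp: finitely_generated_def)
  have "(\<lambda>i. nds_iter f i (Suc n)) ` {1..}
      \<subseteq> (\<lambda>(g, h). g \<circ> h) ` (F \<times> (\<lambda>i. nds_iter f i n) ` {1..})"
    using F(2) by fastforce
  with F(1) Suc show ?case
    by (meson finite_SigmaI finite_imageI finite_subset)
qed

text \<open>After a return to \<open>x\<close> the next maps depend on the time, so the orbit may
  have more than \<open>k\<close> points. Still, each point arises from \<open>x\<close> by a block
  of fewer than \<open>k\<close> maps, and only finitely many such blocks are distinct.\<close>

lemma finite_nds_orbit:
  assumes "finitely_generated f" "periodic_point f x"
  shows "finite (nds_orbit f x)"
proof -
  obtain k where k: "k \<ge> 1" "\<And>n. n \<ge> 1 \<Longrightarrow> nds_iter f 1 (k * n) x = x"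
    using assms(2) by (auto simp: periodic_point_def)
  let ?S = "\<Union>n<k. (\<lambda>h. h x) ` (\<lambda>i. nds_iter f i n) ` {1..}"
  have "nds_orbit f x \<subseteq> ?S"
  proof
    fix y assume "y \<in> nds_orbit f x"
    then obtain m where m: "y = nds_iter f 1 m x"
      by (auto simp: nds_orbit_def)
    \<comment> \<open>Periodicity speaks only of positive multiples of \<open>k\<close>; at time 0
      the iterate is \<open>id\<close>.\<close>
    have ret: "nds_iter f 1 (k * (m div k)) x = x"
      using k(2)[of "m div k"] by (cases "m div k = 0") auto
    have "y = nds_iter f 1 (k * (m div k) + m mod k) x"
      by (simp add: m)
    also have "\<dots> = nds_iter f (1 + k * (m div k)) (m mod k) x"
      using ret by (simp only: nds_iter_add comp_apply)
    finally have "y = nds_iter f (1 + k * (m div k)) (m mod k) x" .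
    moreover have "m mod k \<in> {..<k}" using k(1) by simp
    moreover have "1 + k * (m div k) \<in> {1..}" by simp
    ultimately show "y \<in> ?S" by blast
  qed
  moreover have "finite ?S"
    using finite_nds_iter_maps[OF assms(1)] by blast
  ultimately show ?thesis by (rule finite_subset)
qed

text \<open>Infinitely many \<open>i\<close> yield only finitely many distinct maps, so this is a
  finite intersection of open preimages.\<close>

lemma open_bounded_preimages:
  assumes "nds f" "finitely_generated f" "open B"
  shows "open {z. \<forall>i\<ge>1. \<forall>j\<le>k. nds_iter f i j z \<in> B}"
proof -
  let ?H = "\<Union>j\<le>k. (\<lambda>i. nds_iter f i j) ` {1..}"
  have "finite ?H"
    using finite_nds_iter_maps[OF assms(2)] by blast
  moreover have "open (h -` B)" if "h \<in> ?H" for h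
    using that continuous_on_nds_iter[OF assms(1)] assms(3) by (auto intro: open_vimage)
  ultimately have "open (\<Inter>h\<in>?H. h -` B)" by blast
  also have "(\<Inter>h\<in>?H. h -` B) = {z. \<forall>i\<ge>1. \<forall>j\<le>k. nds_iter f i j z \<in> B}"
    by auto
  finally show ?thesis .
qed

lemma transitive_visits_invariant_set:
  assumes "nds f" "finitely_generated f" "topologically_transitive f"
    and "open W" "W \<noteq> {}" "invariant_set f Q" "e > 0" "k \<ge> 1"
  shows "\<exists>u\<in>W. \<exists>m\<ge>1. \<exists>b\<in>Q. dist b (nds_iter f 1 (k * m) u) < e"
proof -
  define B where "B = (\<Union>b\<in>Q. ball b e)"
  \<comment> \<open>All \<open>i\<close> are allowed because the time of entry into \<open>V\<close>
    is not known in advance.\<close>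
  define V where "V = {z. \<forall>i\<ge>1. \<forall>j\<le>k. nds_iter f i j z \<in> B}"
  have "open V"
    unfolding V_def using assms(1,2) by (rule open_bounded_preimages) (auto simp: B_def)
  moreover have "Q \<subseteq> B" using \<open>e > 0\<close> by (auto simp: B_def)
  then have "Q \<subseteq> V"
    using invariant_set_nds_iter[OF assms(6)] by (auto simp: V_def)
  then have "V \<noteq> {}" using assms(6) by (auto simp: invariant_set_def)
  ultimately obtain n u where nu: "n \<ge> 1" "u \<in> W" "nds_iter f 1 n u \<in> V"
    using assms(3-5) unfolding topologically_transitive_def by blast
  \<comment> \<open>\<open>k * m\<close> is the first multiple of \<open>k\<close> strictly after
    \<open>n\<close>: this gives \<open>m \<ge> 1\<close> and a wait of at most \<open>k\<close>
    steps.\<close>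
  define m where "m = n div k + 1"
  have eq: "n div k * k + n mod k = n" and "n mod k < k"
    using \<open>k \<ge> 1\<close> by simp_all
  moreover have "k * m = n div k * k + k" by (simp add: m_def algebra_simps)
  ultimately have km: "n \<le> k * m" "k * m - n \<le> k" by linarith+
  have "nds_iter f 1 (k * m) u = nds_iter f (1 + n) (k * m - n) (nds_iter f 1 n u)"
    using nds_iter_add[of f 1 n "k * m - n"] km(1) by simp
  also have "\<dots> \<in> B" using nu(3) km(2) by (simp add: V_def)
  finally obtain b where "b \<in> Q" "dist b (nds_iter f 1 (k * m) u) < e"
    by (auto simp: B_def)
  moreover have "m \<ge> 1" by (simp add: m_def)
  ultimately show ?thesis using nu(2) by blast
qed

theorem theorem3:
  fixes f :: "nat \<Rightarrow> 'a::metric_space \<Rightarrow> 'a"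
  assumes "nds f"
    and "finitely_generated f"
    and "topologically_transitive f"
    and "closure {p. periodic_point f p} = UNIV"
    and "\<exists>x y. invariant_periodic_point f x \<and> invariant_periodic_point f y \<and>
           closure (nds_orbit f x) \<inter> closure (nds_orbit f y) = {}"
  shows "sensitive f"
proof -
  obtain x y where xy: "invariant_periodic_point f x" "invariant_periodic_point f y"
    "closure (nds_orbit f x) \<inter> closure (nds_orbit f y) = {}"
    using assms(5) by blast
  let ?C = "closure (nds_orbit f y)"
  have ne: "nds_orbit f x \<noteq> {}" "?C \<noteq> {}"
    using xy(1,2) by (simp_all add: invariant_periodic_point_def invariant_set_def)
  have fin: "finite (nds_orbit f x)"
    using finite_nds_orbit[OF assms(2)] xy(1) by (simp add: invariant_periodic_point_def)
  \<comment> \<open>A minimum of finitely many positive numbers, hence positive.\<close>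
  define d where "d = Min ((\<lambda>a. infdist a ?C) ` nds_orbit f x)"
  have "infdist a ?C > 0" if "a \<in> nds_orbit f x" for a
  proof (rule infdist_pos_not_in_closed)
    show "a \<notin> ?C" using that xy(3) closure_subset by blast
  qed (use ne in auto)
  then have "d > 0" using fin ne by (simp add: d_def)
  have d: "d \<le> dist a b" if "a \<in> nds_orbit f x" "b \<in> nds_orbit f y" for a b
  proof -
    have "d \<le> infdist a ?C" using fin that(1) by (simp add: d_def)
    also have "\<dots> \<le> dist a b" using that(2) closure_subset by (blast intro: infdist_le)
    finally show ?thesis .
  qed
  \<comment> \<open>A point within \<open>4 * e\<close> of both orbits would put them less than
    \<open>8 * e = d\<close> apart.\<close>
  define e where "e = d / 8"
  have "e > 0" using \<open>d > 0\<close> by (simp add: e_def)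
  have far: "\<exists>Q. invariant_set f Q \<and> (\<forall>b\<in>Q. dist z b \<ge> 4 * e)" for z
  proof (rule ccontr)
    assume "\<not> ?thesis"
    then obtain a b where ab: "a \<in> nds_orbit f x" "dist z a < 4 * e"
      "b \<in> nds_orbit f y" "dist z b < 4 * e"
      using xy(1,2) unfolding invariant_periodic_point_def by (meson not_le)
    have "dist a b < d"
      using ab(2,4) dist_triangle3[of a b z] by (simp add: e_def)
    with d[OF ab(1,3)] show False by simp
  qed
  show ?thesis
    unfolding sensitive_def
  proof (intro exI conjI allI impI)
    show "e > 0" by fact
    fix U :: "'a set" assume "open U \<and> U \<noteq> {}"
    then obtain z where z: "z \<in> U" and "open U" by blast
    define W where "W = U \<inter> ball z e"
    have W: "open W" "W \<noteq> {}"
      using \<open>open U\<close> z \<open>e > 0\<close> by (auto simp: W_def)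
    then obtain p where p: "p \<in> W" "periodic_point f p"
      using assms(4) open_Int_closure_eq_empty[of W "{p. periodic_point f p}"] by blast
    then obtain k where k: "k \<ge> 1" "\<And>n. n \<ge> 1 \<Longrightarrow> nds_iter f 1 (k * n) p = p"
      by (auto simp: periodic_point_def)
    obtain Q where Q: "invariant_set f Q" "\<And>b. b \<in> Q \<Longrightarrow> dist z b \<ge> 4 * e"
      using far by blast
    obtain u m b where u: "u \<in> W" "m \<ge> 1" "b \<in> Q" "dist b (nds_iter f 1 (k * m) u) < e"
      using transitive_visits_invariant_set[OF assms(1-3) W Q(1) \<open>e > 0\<close> k(1)] by blast
    let ?v = "nds_iter f 1 (k * m) u"
    \<comment> \<open>Of the distance \<open>4 * e\<close> from \<open>z\<close> to
      \<open>b\<close>, the outer two terms use less than \<open>e\<close> each, so more than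
      \<open>2 * e\<close> is left for \<open>dist p ?v\<close>.\<close>
    have "dist z b \<le> dist z p + dist p ?v + dist b ?v"
      using dist_triangle[of z b p] dist_triangle2[of p b ?v] by linarith
    moreover have "dist z p < e" using p(1) by (simp add: W_def)
    ultimately have "e < dist (nds_iter f 1 (k * m) p) ?v"
      using Q(2)[OF u(3)] u(4) k(2)[OF u(2)] \<open>e > 0\<close> by simp
    moreover have "k * m \<ge> 1" using k(1) u(2) by simp
    moreover have "p \<in> U" "u \<in> U" using p(1) u(1) by (auto simp: W_def)
    ultimately show "\<exists>x\<in>U. \<exists>y\<in>U. \<exists>n\<ge>1. e < dist (nds_iter f 1 n x) (nds_iter f 1 n y)"
      by blast
  qed
qed

end
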